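(* Let $n\ge 1$ and let $s$ be an integer with $n/2<s\le n$. Let $\tilde\gamma_s=(0,\dots,0,1,\dots,1)\in\{0,1\}^n$ be the tuple with $n-s$ zeros followed by $s$ ones. Let $T',T''$ be antichains in $\{0,1\}^n$ (with respect to the componentwise order) such that $\tilde\gamma_s\in T'$ and there are no $\tilde\alpha'\in T'$, $\tilde\alpha''\in T''$ with $\tilde\alpha'\ge\tilde\alpha''$. Then \[ |T'|+|T''|\le 1+\binom{n+1}{\lfloor n/2\rfloor+1}-\binom{s+1}{\lfloor n/2\rfloor+1}. \]
   Context: $\{0,1\}^n$ is partially ordered componentwise: $\tilde\alpha\le\tilde\beta$ iff $\alpha_i\le\beta_i$ for all $i$. An antichain is a set of pairwise incomparable tuples. *)

theory Defs
  imports Complex_Main "HOL-Library.FuncSet"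
begin

text \<open>
  Tuples in $\{0,1\}^n$ are functions on the index set \<open>{1..n}\<close>, extensional outside it, so that
  equality of tuples is equality of functions and the cube is finite.
\<close>

definition cube :: "nat \<Rightarrow> (nat \<Rightarrow> nat) set" where
  "cube n = {1..n} \<rightarrow>\<^sub>E {0, 1}"

definition cube_le :: "nat \<Rightarrow> (nat \<Rightarrow> nat) \<Rightarrow> (nat \<Rightarrow> nat) \<Rightarrow> bool" where
  "cube_le n \<alpha> \<beta> \<longleftrightarrow> (\<forall>i\<in>{1..n}. \<alpha> i \<le> \<beta> i)"

definition cube_antichain :: "nat \<Rightarrow> (nat \<Rightarrow> nat) set \<Rightarrow> bool" where
  "cube_antichain n T \<longleftrightarrow> T \<subseteq> cube n \<and>
     (\<forall>\<alpha>\<in>T. \<forall>\<beta>\<in>T. \<alpha> \<noteq> \<beta> \<longrightarrow> \<not> cube_le n \<alpha> \<beta> \<and> \<not> cube_le n \<beta> \<alpha>)"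

definition gamma_tuple :: "nat \<Rightarrow> nat \<Rightarrow> nat \<Rightarrow> nat" where
  "gamma_tuple n s = (\<lambda>i\<in>{1..n}. if i \<le> n - s then 0 else 1)"

end

theory Submission
  imports Defs
begin

text \<open>
  Identify tuples with subsets of \<open>{1..n}\<close> and add a new point \<open>0\<close> to the members of \<open>T'\<close>: the
  hypotheses say exactly that the resulting sets, together with those from \<open>T''\<close>, form an
  antichain of subsets of an \<open>(n + 1)\<close>-element set. It contains a set \<open>A\<close> of size \<open>s + 1\<close>, and its
  other members lie in the poset \<open>Q\<close> of sets not contained in \<open>A\<close>. In \<open>Q\<close> a set of size \<open>k\<close> still
  has at least \<open>k - 1\<close> lower neighbours (keep one fixed point outside \<open>A\<close>) and all of its upper
  neighbours, so double counting lets one push an antichain of \<open>Q\<close> towards the middle level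
  without loss. The size of that level of \<open>Q\<close> is the difference of binomial coefficients.
\<close>

section \<open>Double counting, and pushing antichains along a rank function\<close>

text \<open>The pairs related by \<open>E\<close> are counted twice: by their first entry there are
  at least \<open>d * card S\<close>, by their second at most \<open>d * card T\<close>.\<close>

lemma card_le_of_degrees:
  assumes "finite S" "finite T" "d > 0"
    and "\<And>x. x \<in> S \<Longrightarrow> d \<le> card {y \<in> T. E x y}"
    and "\<And>y. y \<in> T \<Longrightarrow> card {x \<in> S. E x y} \<le> d"
  shows "card S \<le> card T"
proof -
  have "card S * d \<le> (\<Sum>x\<in>S. card {y \<in> T. E x y})"
    using sum_mono[of S "\<lambda>_. d" "\<lambda>x. card {y \<in> T. E x y}"] assms(4) by simp
  also have "\<dots> = (\<Sum>x\<in>S. \<Sum>y\<in>T. if E x y then 1 else 0)"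
    using assms(2) by (simp add: sum.If_cases Int_def)
  also have "\<dots> = (\<Sum>y\<in>T. \<Sum>x\<in>S. if E x y then 1 else 0)"
    by (rule sum.swap)
  also have "\<dots> = (\<Sum>y\<in>T. card {x \<in> S. E x y})"
    using assms(1) by (simp add: sum.If_cases Int_def)
  also have "\<dots> \<le> card T * d"
    using sum_mono[of T "\<lambda>y. card {x \<in> S. E x y}" "\<lambda>_. d"] assms(5) by simp
  finally show ?thesis
    using assms(3) by simp
qed

text \<open>The members of highest rank are replaced by their shadow one rank below, repeatedly,
  until no rank exceeds \<open>t\<close>. \<open>R x y\<close> reads as "x lies above y"; keeping
  \<open>R\<close> and \<open>r\<close> abstract lets the same lemma push in either direction of
  inclusion. The last clause of the conclusion says that members of rank below \<open>t\<close> are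
  original ones, which is what a second push in the opposite direction relies on.\<close>

lemma antichain_push_down:
  fixes Q :: "'a set" and r :: "'a \<Rightarrow> nat" and R :: "'a \<Rightarrow> 'a \<Rightarrow> bool"
  assumes fin: "finite Q"
    and trans: "\<And>x y z. R x y \<Longrightarrow> R y z \<Longrightarrow> R x z"
    and rank: "\<And>x y. x \<in> Q \<Longrightarrow> y \<in> Q \<Longrightarrow> R x y \<Longrightarrow> r y < r x"
    and shadow: "\<And>k S. t \<le> k \<Longrightarrow> S \<subseteq> {x \<in> Q. r x = Suc k} \<Longrightarrow>
      card S \<le> card {y \<in> Q. r y = k \<and> (\<exists>x\<in>S. R x y)}"
    and "F \<subseteq> Q" "\<forall>x\<in>F. \<forall>y\<in>F. \<not> R x y"
  shows "\<exists>G\<subseteq>Q. (\<forall>x\<in>G. \<forall>y\<in>G. \<not> R x y) \<and> card F \<le> card G \<and>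
    (\<forall>x\<in>G. r x \<le> t \<and> (x \<in> F \<or> r x = t))"
proof -
  have "\<exists>G\<subseteq>Q. (\<forall>x\<in>G. \<forall>y\<in>G. \<not> R x y) \<and> card F \<le> card G \<and>
      (\<forall>x\<in>G. r x \<le> t \<and> (x \<in> F \<or> r x = t))"
    if "F \<subseteq> Q" "\<forall>x\<in>F. \<forall>y\<in>F. \<not> R x y" "\<forall>x\<in>F. r x \<le> t + j" for j F
    using that
  proof (induction j arbitrary: F)
    case 0
    then show ?case by (intro exI[of _ F]) simp
  next
    case (Suc j)
    define k where "k = t + j"
    define S where "S = {x \<in> F. r x = Suc k}"
    define N where "N = {y \<in> Q. r y = k \<and> (\<exists>x\<in>S. R x y)}"
    have finF: "finite F" and finN: "finite N"
      using finite_subset[OF Suc.prems(1) fin] fin by (auto simp: N_def)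
    have SQ: "S \<subseteq> {x \<in> Q. r x = Suc k}"
      using Suc.prems(1) by (auto simp: S_def)
    have SN: "card S \<le> card N"
      unfolding N_def using SQ by (intro shadow) (auto simp: k_def)
    \<comment> \<open>A point of \<open>N\<close> lies below a member of \<open>S\<close>, so it
      cannot belong to the antichain \<open>F\<close>.\<close>
    have disj: "(F - S) \<inter> N = {}"
      using Suc.prems(2) by (auto simp: S_def N_def)
    have "card F = card (F - S) + card S"
      using finF card_mono[of F S] by (simp add: S_def card_Diff_subset)
    also have "\<dots> \<le> card ((F - S) \<union> N)"
      using SN disj finF finN by (simp add: card_Un_disjoint)
    finally have cardF: "card F \<le> card ((F - S) \<union> N)" .
    have top: "r x \<le> k" if "x \<in> F - S" for x
      using that Suc.prems(3) by (force simp: S_def k_def le_Suc_eq)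
    \<comment> \<open>If \<open>b\<close> is in \<open>N\<close>, it has the highest remaining rank
      \<open>k\<close>, so nothing lies above it. If \<open>b\<close> is in \<open>F\<close>, then
      \<open>a\<close> must be in \<open>N\<close>, hence below some \<open>x\<close> in
      \<open>S\<close>, and transitivity would relate \<open>x\<close> and \<open>b\<close> inside
      \<open>F\<close>.\<close>
    have anti: "\<not> R a b" if ab: "a \<in> (F - S) \<union> N" "b \<in> (F - S) \<union> N" for a b
    proof
      assume R: "R a b"
      have "a \<in> Q" "b \<in> Q" using ab Suc.prems(1) by (auto simp: N_def)
      then have lt: "r b < r a" using R rank by blast
      show False
      proof (cases "b \<in> N")
        case True
        then have "r b = k" by (simp add: N_def)
        moreover have "r a \<le> k" using ab(1) top by (auto simp: N_def)
        ultimately show False using lt by simp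
      next
        case False
        then have "b \<in> F" using ab(2) by auto
        then have "a \<in> N" using R ab(1) Suc.prems(2) by auto
        then obtain x where "x \<in> F" "R x a" by (auto simp: N_def S_def)
        then show False using trans[of x a b] R \<open>b \<in> F\<close> Suc.prems(2) by blast
      qed
    qed
    have "\<exists>G\<subseteq>Q. (\<forall>x\<in>G. \<forall>y\<in>G. \<not> R x y) \<and> card ((F - S) \<union> N) \<le> card G \<and>
      (\<forall>x\<in>G. r x \<le> t \<and> (x \<in> (F - S) \<union> N \<or> r x = t))"
    proof (rule Suc.IH)
      show "(F - S) \<union> N \<subseteq> Q" using Suc.prems(1) by (auto simp: N_def)
      show "\<forall>x\<in>(F - S) \<union> N. \<forall>y\<in>(F - S) \<union> N. \<not> R x y" using anti by blast
      show "\<forall>x\<in>(F - S) \<union> N. r x \<le> t + j" using top by (auto simp: N_def k_def)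
    qed
    then obtain G where G: "G \<subseteq> Q" "\<forall>x\<in>G. \<forall>y\<in>G. \<not> R x y" "card ((F - S) \<union> N) \<le> card G"
      "\<forall>x\<in>G. r x \<le> t \<and> (x \<in> (F - S) \<union> N \<or> r x = t)" by blast
    \<comment> \<open>A point of \<open>N\<close> has rank \<open>t + j\<close>, so it can survive
      in \<open>G\<close> only if this rank is \<open>t\<close>.\<close>
    have "x \<in> F \<or> r x = t" if "x \<in> G" for x
      using G(4) that by (force simp: N_def k_def)
    then show ?case using G cardF by (intro exI[of _ G]) auto
  qed
  moreover have "\<forall>x\<in>F. r x \<le> t + Max (r ` F)"
    using assms(5) fin by (auto intro!: trans_le_add2 Max_ge dest: finite_subset)
  ultimately show ?thesis using assms(5,6) by blast
qed

section \<open>Antichains of sets not contained in a fixed set\<close>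

text \<open>The antichain is pushed down and then up until it lies in level \<open>m\<close> of the
  poset of sets not contained in \<open>A\<close>. The bounds on \<open>m\<close> make it half of
  \<open>card U\<close>, rounded up: the first is what pushing down needs, the second what pushing
  up needs.\<close>

lemma card_antichain_not_subset_le:
  fixes U A :: "'a set"
  assumes fin: "finite U" and AU: "A \<subseteq> U"
    and m: "card U \<le> 2 * m" "2 * m \<le> card U + 1" "m > 0"
    and F: "F \<subseteq> {X. X \<subseteq> U \<and> \<not> X \<subseteq> A}" "\<forall>X\<in>F. \<forall>Y\<in>F. \<not> X \<subset> Y"
  shows "card F + (card A choose m) \<le> (card U choose m)"
proof -
  define Q where "Q = {X. X \<subseteq> U \<and> \<not> X \<subseteq> A}"
  have finQ: "finite Q" unfolding Q_def using fin by simp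
  have finX: "finite X" if "X \<subseteq> U" for X using that fin finite_subset by blast
  have down: "card S \<le> card {Y \<in> Q. card Y = k \<and> (\<exists>X\<in>S. X \<supset> Y)}"
    if k: "m \<le> k" and S: "S \<subseteq> {X \<in> Q. card X = Suc k}" for k S
  proof (rule card_le_of_degrees[where d = k and E = "\<lambda>X Y. Y \<subset> X"])
    show "finite S" "finite {Y \<in> Q. card Y = k \<and> (\<exists>X\<in>S. X \<supset> Y)}"
      using finite_subset[OF S] finQ by auto
    show "0 < k" using k m by simp
    show "k \<le> card {Y \<in> {Y \<in> Q. card Y = k \<and> (\<exists>X\<in>S. X \<supset> Y)}. Y \<subset> X}" if X: "X \<in> S" for X
    proof -
      have XU: "X \<subseteq> U" "card X = Suc k" and "\<not> X \<subseteq> A" using X S by (auto simp: Q_def)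
      then obtain b where b: "b \<in> X" "b \<notin> A" by blast
      \<comment> \<open>Deleting any point other than \<open>b\<close> keeps \<open>b\<close>, so
        the smaller set is still not contained in \<open>A\<close>.\<close>
      have "k = card ((\<lambda>x. X - {x}) ` (X - {b}))"
        using XU b by (subst card_image) (auto simp: inj_on_def)
      also have "\<dots> \<le> card {Y \<in> {Y \<in> Q. card Y = k \<and> (\<exists>X\<in>S. X \<supset> Y)}. Y \<subset> X}"
      proof (rule card_mono)
        show "finite {Y \<in> {Y \<in> Q. card Y = k \<and> (\<exists>X\<in>S. X \<supset> Y)}. Y \<subset> X}" using finQ by simp
        show "(\<lambda>x. X - {x}) ` (X - {b}) \<subseteq> {Y \<in> {Y \<in> Q. card Y = k \<and> (\<exists>X\<in>S. X \<supset> Y)}. Y \<subset> X}"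
          using XU b X by (fastforce simp: Q_def)
      qed
      finally show ?thesis .
    qed
    show "card {X \<in> S. Y \<subset> X} \<le> k" if "Y \<in> {Y \<in> Q. card Y = k \<and> (\<exists>X\<in>S. X \<supset> Y)}" for Y
    proof -
      have Y: "Y \<subseteq> U" "card Y = k" using that by (auto simp: Q_def)
      have "{X \<in> S. Y \<subset> X} \<subseteq> (\<lambda>x. insert x Y) ` (U - Y)"
      proof
        fix X assume "X \<in> {X \<in> S. Y \<subset> X}"
        then have X: "X \<in> S" "Y \<subset> X" "X \<subseteq> U" "card X = Suc k" using S by (auto simp: Q_def)
        then obtain x where x: "x \<in> X" "x \<notin> Y" by blast
        have "insert x Y = X"
          using X x Y finX by (intro card_subset_eq) auto
        then show "X \<in> (\<lambda>x. insert x Y) ` (U - Y)" using x X by blast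
      qed
      then have "card {X \<in> S. Y \<subset> X} \<le> card (U - Y)"
        using fin by (meson finite_Diff surj_card_le)
      also have "\<dots> = card U - k" using Y fin finX by (simp add: card_Diff_subset)
      \<comment> \<open>From level \<open>m\<close> upwards, \<open>k\<close> is at least half of
        \<open>card U\<close>; this absorbs the one neighbour lost to \<open>b\<close>.\<close>
      also have "\<dots> \<le> k" using k m by simp
      finally show ?thesis .
    qed
  qed
  have up: "card S \<le> card {Y \<in> Q. card U - card Y = k \<and> (\<exists>X\<in>S. X \<subset> Y)}"
    if k: "card U - m \<le> k" and S: "S \<subseteq> {X \<in> Q. card U - card X = Suc k}" for k S
  proof (rule card_le_of_degrees[where d = "Suc k" and E = "\<lambda>X Y. X \<subset> Y"])
    show "finite S" "finite {Y \<in> Q. card U - card Y = k \<and> (\<exists>X\<in>S. X \<subset> Y)}"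
      using finite_subset[OF S] finQ by auto
    show "0 < Suc k" by simp
    show "Suc k \<le> card {Y \<in> {Y \<in> Q. card U - card Y = k \<and> (\<exists>X\<in>S. X \<subset> Y)}. X \<subset> Y}"
      if X: "X \<in> S" for X
    proof -
      have XU: "X \<subseteq> U" "card U - card X = Suc k" "\<not> X \<subseteq> A" using X S by (auto simp: Q_def)
      \<comment> \<open>Enlarging \<open>X\<close> cannot make it a subset of \<open>A\<close>, so
        no upper neighbour is lost.\<close>
      have "Suc k = card ((\<lambda>x. insert x X) ` (U - X))"
        using XU finX by (subst card_image) (auto simp: inj_on_def card_Diff_subset)
      also have "\<dots> \<le> card {Y \<in> {Y \<in> Q. card U - card Y = k \<and> (\<exists>X\<in>S. X \<subset> Y)}. X \<subset> Y}"
      proof (rule card_mono)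
        show "finite {Y \<in> {Y \<in> Q. card U - card Y = k \<and> (\<exists>X\<in>S. X \<subset> Y)}. X \<subset> Y}"
          using finQ by simp
        show "(\<lambda>x. insert x X) ` (U - X) \<subseteq>
            {Y \<in> {Y \<in> Q. card U - card Y = k \<and> (\<exists>X\<in>S. X \<subset> Y)}. X \<subset> Y}"
          using XU X finX by (fastforce simp: Q_def)
      qed
      finally show ?thesis .
    qed
    show "card {X \<in> S. X \<subset> Y} \<le> Suc k"
      if "Y \<in> {Y \<in> Q. card U - card Y = k \<and> (\<exists>X\<in>S. X \<subset> Y)}" for Y
    proof -
      have Y: "Y \<subseteq> U" "card U - card Y = k" using that by (auto simp: Q_def)
      have cY: "card Y \<le> card U" using Y fin by (simp add: card_mono)
      have "{X \<in> S. X \<subset> Y} \<subseteq> (\<lambda>x. Y - {x}) ` Y"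
      proof
        fix X assume "X \<in> {X \<in> S. X \<subset> Y}"
        then have X: "X \<subset> Y" "X \<subseteq> U" "card U - card X = Suc k" using S by (auto simp: Q_def)
        then obtain x where x: "x \<in> Y" "x \<notin> X" by blast
        have "X = Y - {x}"
          using X x Y cY finX by (intro card_subset_eq) auto
        then show "X \<in> (\<lambda>x. Y - {x}) ` Y" using x by blast
      qed
      then have "card {X \<in> S. X \<subset> Y} \<le> card Y"
        using finX[OF Y(1)] by (meson surj_card_le)
      \<comment> \<open>Here \<open>card Y\<close> is at most \<open>m\<close>, while
        \<open>Suc k\<close> is at least \<open>card U - m + 1\<close>, which is at least
        \<open>m\<close> since \<open>2 * m\<close> is at most \<open>card U + 1\<close>.\<close>
      also have "\<dots> \<le> Suc k" using k m Y cY by linarith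
      finally show ?thesis .
    qed
  qed
  have "\<exists>G\<subseteq>Q. (\<forall>X\<in>G. \<forall>Y\<in>G. \<not> X \<supset> Y) \<and> card F \<le> card G \<and>
      (\<forall>X\<in>G. card X \<le> m \<and> (X \<in> F \<or> card X = m))"
  proof (rule antichain_push_down[where r = card and R = "\<lambda>X Y. Y \<subset> X"])
    show "card Y < card X" if "X \<in> Q" "Y \<in> Q" "Y \<subset> X" for X Y
      using that finX by (auto simp: Q_def intro: psubset_card_mono)
    show "F \<subseteq> Q" using F(1) by (simp add: Q_def)
    show "\<forall>X\<in>F. \<forall>Y\<in>F. \<not> Y \<subset> X" using F(2) by blast
    show "Z \<subset> X" if "Y \<subset> X" "Z \<subset> Y" for X Y Z using that by order
    show "card S \<le> card {Y \<in> Q. card Y = k \<and> (\<exists>X\<in>S. Y \<subset> X)}"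
      if "m \<le> k" "S \<subseteq> {X \<in> Q. card X = Suc k}" for k S
      using that by (rule down)
  qed (fact finQ)
  then obtain G where G: "G \<subseteq> Q" "\<forall>X\<in>G. \<forall>Y\<in>G. \<not> X \<supset> Y" "card F \<le> card G"
    "\<forall>X\<in>G. card X \<le> m \<and> (X \<in> F \<or> card X = m)"
    by (elim exE conjE) (rule that)
  \<comment> \<open>The second push reverses inclusion and ranks sets by the size of their
    complement, raising the sets smaller than \<open>m\<close>.\<close>
  have "\<exists>H\<subseteq>Q. (\<forall>X\<in>H. \<forall>Y\<in>H. \<not> X \<subset> Y) \<and> card G \<le> card H \<and>
      (\<forall>X\<in>H. card U - card X \<le> card U - m \<and> (X \<in> G \<or> card U - card X = card U - m))"
  proof (rule antichain_push_down[where r = "\<lambda>X. card U - card X" and R = "\<lambda>X Y. X \<subset> Y"])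
    show "card U - card Y < card U - card X" if "X \<in> Q" "Y \<in> Q" "X \<subset> Y" for X Y
    proof -
      have "card X < card Y" "card Y \<le> card U"
        using that finX fin by (auto simp: Q_def intro: psubset_card_mono card_mono)
      then show ?thesis by simp
    qed
    show "X \<subset> Z" if "X \<subset> Y" "Y \<subset> Z" for X Y Z using that by order
    show "card S \<le> card {Y \<in> Q. card U - card Y = k \<and> (\<exists>X\<in>S. X \<subset> Y)}"
      if "card U - m \<le> k" "S \<subseteq> {X \<in> Q. card U - card X = Suc k}" for k S
      using that by (rule up)
    show "\<forall>X\<in>G. \<forall>Y\<in>G. \<not> X \<subset> Y" using G(2) by simp
  qed (fact finQ G(1))+
  then obtain H where H: "H \<subseteq> Q" "card G \<le> card H"
    "\<forall>X\<in>H. card U - card X \<le> card U - m \<and> (X \<in> G \<or> card U - card X = card U - m)"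
    by (elim exE conjE) (rule that)
  have mU: "m \<le> card U" using m by linarith
  have "H \<subseteq> {X. X \<subseteq> U \<and> card X = m} - {X. X \<subseteq> A \<and> card X = m}"
  proof
    fix X assume X: "X \<in> H"
    then have "X \<subseteq> U" "\<not> X \<subseteq> A" using H(1) by (auto simp: Q_def)
    moreover have "card X \<le> card U" using \<open>X \<subseteq> U\<close> fin by (simp add: card_mono)
    \<comment> \<open>A set kept from \<open>G\<close> has size at most \<open>m\<close> by the
      first push and at least \<open>m\<close> by the second; every other set has size
      \<open>m\<close> directly.\<close>
    then have "card X = m" using H(3) G(4) X mU by (metis diff_diff_cancel diff_le_mono2 le_antisym)
    ultimately show "X \<in> {X. X \<subseteq> U \<and> card X = m} - {X. X \<subseteq> A \<and> card X = m}" by simp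
  qed
  then have "card H \<le> card ({X. X \<subseteq> U \<and> card X = m} - {X. X \<subseteq> A \<and> card X = m})"
    using fin by (intro card_mono) auto
  also have "\<dots> = (card U choose m) - (card A choose m)"
    using AU fin finX by (subst card_Diff_subset) (auto simp: n_subsets)
  finally have "card H \<le> (card U choose m) - (card A choose m)" .
  moreover have "(card A choose m) \<le> (card U choose m)"
    using AU fin by (intro binomial_right_mono card_mono) auto
  ultimately show ?thesis using G(3) H(2) by linarith
qed

section \<open>Translation of tuples into sets\<close>

definition tuple_support :: "nat \<Rightarrow> (nat \<Rightarrow> nat) \<Rightarrow> nat set" where
  "tuple_support n \<alpha> = {i \<in> {1..n}. \<alpha> i = 1}"

lemma tuple_support_subset_iff:
  assumes "\<alpha> \<in> cube n" "\<beta> \<in> cube n"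
  shows "tuple_support n \<alpha> \<subseteq> tuple_support n \<beta> \<longleftrightarrow> cube_le n \<alpha> \<beta>"
proof -
  have "(\<alpha> i = 1 \<longrightarrow> \<beta> i = 1) \<longleftrightarrow> \<alpha> i \<le> \<beta> i" if "i \<in> {1..n}" for i
  proof -
    have "\<alpha> i \<in> {0, 1}" "\<beta> i \<in> {0, 1}"
      using assms that unfolding cube_def by (blast dest: PiE_mem)+
    then show ?thesis by auto
  qed
  then show ?thesis
    by (auto simp: tuple_support_def cube_le_def subset_iff)
qed

lemma inj_on_tuple_support: "inj_on (tuple_support n) (cube n)"
proof (rule inj_onI)
  fix \<alpha> \<beta> assume ab: "\<alpha> \<in> cube n" "\<beta> \<in> cube n" "tuple_support n \<alpha> = tuple_support n \<beta>"
  then have "cube_le n \<alpha> \<beta>" "cube_le n \<beta> \<alpha>"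
    using tuple_support_subset_iff by blast+
  then show "\<alpha> = \<beta>"
    using ab by (intro PiE_ext[of _ "{1..n}" "\<lambda>_. {0, 1}"]) (auto simp: cube_def cube_le_def intro: le_antisym)
qed

lemma card_tuple_support_gamma:
  assumes "s \<le> n"
  shows "card (tuple_support n (gamma_tuple n s)) = s"
proof -
  have "tuple_support n (gamma_tuple n s) = {n - s<..n}"
    by (auto simp: tuple_support_def gamma_tuple_def split: if_splits)
  then show ?thesis using assms by simp
qed

theorem theorem1:
  fixes n s :: nat and T' T'' :: "(nat \<Rightarrow> nat) set"
  assumes "n \<ge> 1"
    and "real n / 2 < real s" and "s \<le> n"
    and "cube_antichain n T'" and "cube_antichain n T''"
    and "gamma_tuple n s \<in> T'"
    and "\<not> (\<exists>\<alpha>'\<in>T'. \<exists>\<alpha>''\<in>T''. cube_le n \<alpha>'' \<alpha>')"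
  shows "int (card T') + int (card T'') \<le>
    1 + int ((n + 1) choose (n div 2 + 1)) - int ((s + 1) choose (n div 2 + 1))"
proof -
  define supp where "supp = tuple_support n"
  define F' where "F' = (\<lambda>\<alpha>. insert 0 (supp \<alpha>)) ` T'"
  define F'' where "F'' = supp ` T''"
  define A where "A = insert 0 (supp (gamma_tuple n s))"
  have cube: "T' \<subseteq> cube n" "T'' \<subseteq> cube n"
    using assms(4,5) by (auto simp: cube_antichain_def)
  have supp: "0 \<notin> supp \<alpha>" "supp \<alpha> \<subseteq> {0..n}" for \<alpha>
    by (auto simp: supp_def tuple_support_def)
  have le: "supp \<alpha> \<subseteq> supp \<beta> \<longleftrightarrow> cube_le n \<alpha> \<beta>" if "\<alpha> \<in> T' \<union> T''" "\<beta> \<in> T' \<union> T''" for \<alpha> \<beta>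
    unfolding supp_def using that cube by (intro tuple_support_subset_iff) auto
  have ins: "insert 0 (supp \<alpha>) \<subseteq> insert 0 (supp \<beta>) \<longleftrightarrow> supp \<alpha> \<subseteq> supp \<beta>"
    "supp \<alpha> \<subseteq> insert 0 (supp \<beta>) \<longleftrightarrow> supp \<alpha> \<subseteq> supp \<beta>"
    "\<not> insert 0 (supp \<alpha>) \<subseteq> supp \<beta>" for \<alpha> \<beta>
    using supp(1) by blast+
  have inj: "inj_on supp (cube n)"
    unfolding supp_def by (rule inj_on_tuple_support)
  have inj': "inj_on (\<lambda>\<alpha>. insert 0 (supp \<alpha>)) (cube n)"
    using inj ins(1) unfolding inj_on_def by (metis subset_antisym subset_refl)
  have subU: "F' \<union> F'' \<subseteq> Pow {0..n}"
    using supp(2) by (auto simp: F'_def F''_def)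
  then have fin: "finite F'" "finite F''"
    using finite_subset[of _ "Pow {0..n}"] by auto
  have "F' \<inter> F'' = {}"
    using supp(1) by (auto simp: F'_def F''_def)
  then have "card (F' \<union> F'') = card F' + card F''"
    using fin by (simp add: card_Un_disjoint)
  also have "card F' = card T'"
    unfolding F'_def using inj' cube by (intro card_image) (rule inj_on_subset)
  also have "card F'' = card T''"
    unfolding F''_def using inj cube by (intro card_image) (rule inj_on_subset)
  finally have card: "card (F' \<union> F'') = card T' + card T''" .
  have anti: "X = Y" if XY: "X \<in> F' \<union> F''" "Y \<in> F' \<union> F''" "X \<subseteq> Y" for X Y
  proof -
    have T': "\<alpha> = \<beta>" if "\<alpha> \<in> T'" "\<beta> \<in> T'" "supp \<alpha> \<subseteq> supp \<beta>" for \<alpha> \<beta>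
      using that le assms(4) unfolding cube_antichain_def by blast
    have T'': "\<alpha> = \<beta>" if "\<alpha> \<in> T''" "\<beta> \<in> T''" "supp \<alpha> \<subseteq> supp \<beta>" for \<alpha> \<beta>
      using that le assms(5) unfolding cube_antichain_def by blast
    have cross: "\<not> supp \<alpha> \<subseteq> supp \<beta>" if "\<alpha> \<in> T''" "\<beta> \<in> T'" for \<alpha> \<beta>
      using that le assms(7) by blast
    \<comment> \<open>In the second case the point 0 lies in \<open>X\<close> but not in
      \<open>Y\<close>, so a tuple of \<open>T'\<close> may well lie below one of
      \<open>T''\<close>. The third case is the relation forbidden between \<open>T'\<close> and
      \<open>T''\<close>.\<close>
    consider "X \<in> F'" "Y \<in> F'" | "X \<in> F'" "Y \<in> F''" | "X \<in> F''" "Y \<in> F'" | "X \<in> F''" "Y \<in> F''"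
      using XY by blast
    then show ?thesis
    proof cases
      case 1
      then obtain \<alpha> \<beta> where "\<alpha> \<in> T'" "X = insert 0 (supp \<alpha>)" "\<beta> \<in> T'" "Y = insert 0 (supp \<beta>)"
        by (auto simp: F'_def)
      then show ?thesis using T' XY(3) ins(1) by metis
    next
      case 2
      then show ?thesis using XY(3) ins(3) by (auto simp: F'_def F''_def)
    next
      case 3
      then obtain \<alpha> \<beta> where "\<alpha> \<in> T''" "X = supp \<alpha>" "\<beta> \<in> T'" "Y = insert 0 (supp \<beta>)"
        by (auto simp: F'_def F''_def)
      then show ?thesis using cross XY(3) ins(2) by metis
    next
      case 4
      then show ?thesis using T'' XY(3) by (auto simp: F''_def)
    qed
  qed
  have A: "A \<in> F' \<union> F''" using assms(6) by (simp add: A_def F'_def)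
  \<comment> \<open>The ground set has \<open>n + 1\<close> points, and \<open>n div 2 + 1\<close>
    is half of that, rounded up. Removing \<open>A\<close> itself accounts for the summand 1 in the
    bound.\<close>
  have "card (F' \<union> F'' - {A}) + (card A choose (n div 2 + 1)) \<le> (card {0..n} choose (n div 2 + 1))"
  proof (rule card_antichain_not_subset_le)
    show "A \<subseteq> {0..n}" using A subU by blast
    show "F' \<union> F'' - {A} \<subseteq> {X. X \<subseteq> {0..n} \<and> \<not> X \<subseteq> A}"
      using subU anti A by blast
    show "\<forall>X\<in>F' \<union> F'' - {A}. \<forall>Y\<in>F' \<union> F'' - {A}. \<not> X \<subset> Y"
      using anti by blast
  qed auto
  moreover have "card A = s + 1"
    using card_tuple_support_gamma[OF assms(3)] supp(1) finite_subset[OF supp(2)]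
    by (simp add: A_def supp_def)
  moreover have "card (F' \<union> F'') = card (F' \<union> F'' - {A}) + 1"
    using A fin by (metis Suc_eq_plus1 card.remove finite_UnI)
  ultimately show ?thesis using card by simp
qed

end
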